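(* Let $A\in\mathbb{R}^{m\times c}$, $B\in\mathbb{R}^c$, let $N_A\in\mathbb{R}^{c\times k}$ be a nullspace basis matrix of $A$, and let $B_A= N_A^\top B$. The maximum of the linear program $$\max_{\mu\in\mathbb{R}^k}\ \{-B^\top N_A\mu\}\quad\text{s.t.}\quad N_A\mu\ge 0$$ is bounded if and only if the linear program $$\min_{\nu\in\mathbb{R}^c}\ \{1_c^\top\nu\}\quad\text{s.t.}\quad N_A^\top\nu=B_A,\quad \nu\ge 0$$ is feasible.
   Context: Vector inequalities are element-wise and $1_c\in\mathbb{R}^c$ is the all-ones vector. A nullspace basis matrix of $A$ is a matrix $N_A\in\mathbb{R}^{c\times k}$, $k=\dim\ker A$, whose columns form a basis of $\{\lambda\in\mathbb{R}^c\mid A\lambda=0\}$. The maximum is bounded if the objective is bounded from above on the feasible set (supremum $<\infty$). A linear program is feasible if its constraints admit at least one solution. *)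

theory Defs
  imports Complex_Main "Jordan_Normal_Form.Matrix_Kernel"
begin

text \<open>
  The columns of \<open>N\<close>, as a family, form a basis of the kernel of \<open>A\<close>. Since
  \<open>kernel.basis\<close> is a predicate on sets of vectors, repeated columns are excluded
  separately. The number of columns may be zero.
\<close>

definition nullspace_basis_matrix :: "real mat \<Rightarrow> real mat \<Rightarrow> bool" where
  "nullspace_basis_matrix A N \<longleftrightarrow>
     N \<in> carrier_mat (dim_col A) (kernel.dim (dim_col A) A) \<and>
     distinct (cols N) \<and>
     kernel.basis (dim_col A) A (set (cols N))"

record linear_program =
  objective :: "real vec \<Rightarrow> real"
  feasible_set :: "real vec set"

text \<open>
  Whether the objective is to be maximized or minimized is not part of the record.
  Boundedness of the maximum only asks for a finite upper bound on the feasible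
  set; it does not ask that the supremum be attained.
\<close>

definition lp_feasible :: "linear_program \<Rightarrow> bool" where
  "lp_feasible P \<longleftrightarrow> feasible_set P \<noteq> {}"

definition lp_max_bounded :: "linear_program \<Rightarrow> bool" where
  "lp_max_bounded P \<longleftrightarrow> bdd_above (objective P ` feasible_set P)"

abbreviation ones_vec :: "nat \<Rightarrow> real vec" where
  "ones_vec n \<equiv> vec n (\<lambda>_. 1)"

end

theory Submission
  imports Defs
begin

text \<open>
  Since \<open>B \<bullet> (N *\<^sub>v \<mu>) = (N\<^sup>T *\<^sub>v B) \<bullet> \<mu>\<close> and the feasible \<open>\<mu>\<close> form a cone, the maximum is bounded iff
  \<open>N *\<^sub>v \<mu> \<ge> 0\<close> implies \<open>(N\<^sup>T *\<^sub>v B) \<bullet> \<mu> \<ge> 0\<close>. By Farkas' lemma, applied to the rows of \<open>N\<close>, this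
  means that \<open>N\<^sup>T *\<^sub>v B\<close> is a nonnegative combination of these rows.
\<close>

text \<open>
  Bartl's induction: a point \<open>y\<close> with \<open>b \<bullet> y < 0\<close> violating only the last inequality is scaled so that
  \<open>a n \<bullet> y = -1\<close>; then \<open>x \<mapsto> x + (a n \<bullet> x) y\<close> projects onto the hyperplane \<open>a n \<bullet> x = 0\<close>, and the
  induction hypothesis applies to the functionals composed with this projection.
\<close>

lemma farkas_vec:
  fixes a :: "nat \<Rightarrow> real vec" and b :: "real vec"
  assumes "\<And>i. i < n \<Longrightarrow> a i \<in> carrier_vec k" and "b \<in> carrier_vec k"
    and "\<And>x. x \<in> carrier_vec k \<Longrightarrow> (\<And>i. i < n \<Longrightarrow> 0 \<le> a i \<bullet> x) \<Longrightarrow> 0 \<le> b \<bullet> x"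
  shows "\<exists>l. (\<forall>i<n. 0 \<le> l i) \<and> (\<forall>x\<in>carrier_vec k. b \<bullet> x = (\<Sum>i<n. l i * (a i \<bullet> x)))"
  using assms
proof (induction n arbitrary: a b)
  case 0
  \<comment> \<open>Without constraints both \<open>x\<close> and \<open>- x\<close> are admissible,
    so \<open>b\<close> vanishes on all of the space, in agreement with the empty sum.\<close>
  have "b \<bullet> x = 0" if x: "x \<in> carrier_vec k" for x
  proof -
    have "0 \<le> b \<bullet> x" "0 \<le> b \<bullet> (- x)"
      by (rule "0.prems"(3); use x in simp)+
    then show ?thesis
      using x \<open>b \<in> carrier_vec k\<close> by simp
  qed
  then show ?case
    by simp
next
  case (Suc n)
  have a: "a i \<in> carrier_vec k" if "i < Suc n" for i
    using Suc.prems(1) that .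
  note b = \<open>b \<in> carrier_vec k\<close>
  show ?case
  proof (cases "\<forall>x\<in>carrier_vec k. (\<forall>i<n. 0 \<le> a i \<bullet> x) \<longrightarrow> 0 \<le> b \<bullet> x")
    case True
    have "\<exists>l. (\<forall>i<n. 0 \<le> l i) \<and> (\<forall>x\<in>carrier_vec k. b \<bullet> x = (\<Sum>i<n. l i * (a i \<bullet> x)))"
      by (rule Suc.IH) (use True a b in auto)
    then obtain l where "\<forall>i<n. 0 \<le> l i"
      "\<forall>x\<in>carrier_vec k. b \<bullet> x = (\<Sum>i<n. l i * (a i \<bullet> x))"
      by blast
    \<comment> \<open>The last inequality is redundant here and gets coefficient 0.\<close>
    then show ?thesis
      by (intro exI[of _ "l(n := 0)"]) (auto simp: less_Suc_eq)
  next
    case False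
    then obtain z where z: "z \<in> carrier_vec k" "\<And>i. i < n \<Longrightarrow> 0 \<le> a i \<bullet> z" "b \<bullet> z < 0"
      by force
    \<comment> \<open>Otherwise \<open>z\<close> would satisfy all \<open>Suc n\<close>
      inequalities, contradicting \<open>b \<bullet> z < 0\<close>.\<close>
    then have neg: "a n \<bullet> z < 0"
      using Suc.prems(3)[of z] by (metis less_Suc_eq not_less)
    define y where "y = (1 / - (a n \<bullet> z)) \<cdot>\<^sub>v z"
    have y: "y \<in> carrier_vec k" "\<And>i. i < n \<Longrightarrow> 0 \<le> a i \<bullet> y" "b \<bullet> y \<le> 0" "a n \<bullet> y = -1"
      using z neg a b
      by (auto simp: y_def divide_simps scalar_prod_smult_distrib[where n = k])
    \<comment> \<open>The adjoint of the projection: \<open>p v\<close> represents the functional of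
      \<open>v\<close> composed with it, as \<open>p_adjoint\<close> confirms.\<close>
    define p where "p v = v + (v \<bullet> y) \<cdot>\<^sub>v a n" for v
    have p: "p v \<in> carrier_vec k" if "v \<in> carrier_vec k" for v
      using that a by (simp add: p_def)
    have p_scalar: "p v \<bullet> x = v \<bullet> x + (v \<bullet> y) * (a n \<bullet> x)"
      if "v \<in> carrier_vec k" "x \<in> carrier_vec k" for v x
      using that a[of n] by (simp add: p_def add_scalar_prod_distrib[where n = k])
    have p_adjoint: "p v \<bullet> x = v \<bullet> (x + (a n \<bullet> x) \<cdot>\<^sub>v y)"
      if "v \<in> carrier_vec k" "x \<in> carrier_vec k" for v x
      using that y(1) by (simp add: p_scalar scalar_prod_add_distrib[where n = k])
    have pb_nonneg: "0 \<le> p b \<bullet> x"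
      if x: "x \<in> carrier_vec k" and nonneg: "\<And>i. i < n \<Longrightarrow> 0 \<le> p (a i) \<bullet> x" for x
    proof -
      \<comment> \<open>The projection of \<open>x\<close> turns the last inequality into an
        equality, so the hypothesis on all \<open>Suc n\<close> inequalities applies to it.\<close>
      let ?x = "x + (a n \<bullet> x) \<cdot>\<^sub>v y"
      have "a n \<bullet> ?x = 0"
        using x y a[of n] by (simp add: scalar_prod_add_distrib[where n = k])
      moreover have "0 \<le> a i \<bullet> ?x" if "i < n" for i
        using nonneg[OF that] p_adjoint[of "a i" x] a x that by simp
      ultimately have "0 \<le> b \<bullet> ?x"
        using x y(1) by (intro Suc.prems(3)) (auto simp: less_Suc_eq)
      then show ?thesis
        using p_adjoint b x by simp
    qed
    have "\<exists>l. (\<forall>i<n. 0 \<le> l i) \<and>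
        (\<forall>x\<in>carrier_vec k. p b \<bullet> x = (\<Sum>i<n. l i * (p (a i) \<bullet> x)))"
      using a by (intro Suc.IH p b pb_nonneg) auto
    then obtain l where l: "\<forall>i<n. 0 \<le> l i"
      and pb: "\<forall>x\<in>carrier_vec k. p b \<bullet> x = (\<Sum>i<n. l i * (p (a i) \<bullet> x))"
      by blast
    \<comment> \<open>The coefficient of \<open>a n \<bullet> x\<close> once \<open>p\<close> is
      expanded on both sides of \<open>pb\<close> and the term with \<open>b \<bullet> y\<close> is
      moved to the right. Its sign comes from \<open>b \<bullet> y \<le> 0\<close> and
      \<open>a i \<bullet> y \<ge> 0\<close>.\<close>
    define t where "t = (\<Sum>i<n. l i * (a i \<bullet> y)) - b \<bullet> y"
    have "0 \<le> t"
      unfolding t_def using l y(2,3) by (smt (verit) lessThan_iff mult_nonneg_nonneg sum_nonneg)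
    moreover have "b \<bullet> x = (\<Sum>i<n. l i * (a i \<bullet> x)) + t * (a n \<bullet> x)"
      if x: "x \<in> carrier_vec k" for x
    proof -
      have "b \<bullet> x + (b \<bullet> y) * (a n \<bullet> x) = (\<Sum>i<n. l i * (a i \<bullet> x + (a i \<bullet> y) * (a n \<bullet> x)))"
        using pb x b a by (simp add: p_scalar)
      then show ?thesis
        by (simp add: t_def algebra_simps sum.distrib sum_distrib_left sum_distrib_right)
    qed
    ultimately show ?thesis
      using l by (intro exI[of _ "l(n := t)"]) (auto simp: less_Suc_eq)
  qed
qed

lemma nonneg_scalar_prod:
  fixes v w :: "real vec"
  assumes "0\<^sub>v c \<le> v" "0\<^sub>v c \<le> w"
  shows "0 \<le> v \<bullet> w"
  using assms by (auto simp: less_eq_vec_def scalar_prod_def intro!: sum_nonneg)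

text \<open>The entries of \<open>N *\<^sub>v x\<close> are the products of the rows of
  \<open>N\<close> with \<open>x\<close>, so \<open>farkas_vec\<close> applies to the rows; its
  coefficients are the entries of the witness.\<close>

lemma farkas_mat:
  fixes N :: "real mat"
  assumes N: "N \<in> carrier_mat c k" and b: "b \<in> carrier_vec k"
    and nonneg: "\<And>x. x \<in> carrier_vec k \<Longrightarrow> 0\<^sub>v c \<le> N *\<^sub>v x \<Longrightarrow> 0 \<le> b \<bullet> x"
  obtains v where "v \<in> carrier_vec c" "transpose_mat N *\<^sub>v v = b" "0\<^sub>v c \<le> v"
proof -
  have "\<exists>l. (\<forall>i<c. 0 \<le> l i) \<and> (\<forall>x\<in>carrier_vec k. b \<bullet> x = (\<Sum>i<c. l i * (row N i \<bullet> x)))"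
    using N by (intro farkas_vec b nonneg) (auto simp: less_eq_vec_def)
  then obtain l where l: "\<forall>i<c. 0 \<le> l i"
    and comb: "\<forall>x\<in>carrier_vec k. b \<bullet> x = (\<Sum>i<c. l i * (row N i \<bullet> x))"
    by blast
  have "transpose_mat N *\<^sub>v vec c l = b"
  proof (rule eq_vecI)
    fix j assume "j < dim_vec b"
    then have j: "j < k"
      using b by simp
    \<comment> \<open>Testing the identity of functionals on unit vectors gives equality of the
      vectors entry by entry.\<close>
    have "b $ j = b \<bullet> unit_vec k j"
      using b j by simp
    also have "\<dots> = (\<Sum>i<c. l i * N $$ (i, j))"
      unfolding bspec[OF comb unit_vec_carrier] using N j by (intro sum.cong) auto
    finally show "(transpose_mat N *\<^sub>v vec c l) $ j = b $ j"
      using N j by (simp add: scalar_prod_def mult.commute lessThan_atLeast0)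
  qed (use N b in simp)
  then show thesis
    using that[of "vec c l"] l by (simp add: less_eq_vec_def)
qed

theorem proposition3:
  fixes A N\<^sub>A :: "real mat" and B B\<^sub>A :: "real vec" and m c k :: nat
  assumes "A \<in> carrier_mat m c"
    and "B \<in> carrier_vec c"
    and "N\<^sub>A \<in> carrier_mat c k"
    and "nullspace_basis_matrix A N\<^sub>A"
    and "B\<^sub>A = transpose_mat N\<^sub>A *\<^sub>v B"
  shows "lp_max_bounded
           \<lparr> objective = (\<lambda>\<mu>. - (B \<bullet> (N\<^sub>A *\<^sub>v \<mu>))),
             feasible_set = {\<mu> \<in> carrier_vec k. N\<^sub>A *\<^sub>v \<mu> \<ge> 0\<^sub>v c} \<rparr>
     \<longleftrightarrow> lp_feasible
           \<lparr> objective = (\<lambda>\<nu>. ones_vec c \<bullet> \<nu>),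
             feasible_set = {\<nu> \<in> carrier_vec c. transpose_mat N\<^sub>A *\<^sub>v \<nu> = B\<^sub>A \<and> \<nu> \<ge> 0\<^sub>v c} \<rparr>"
proof -
  note N = \<open>N\<^sub>A \<in> carrier_mat c k\<close>
  have B\<^sub>A: "B\<^sub>A \<in> carrier_vec k"
    using assms by simp
  have obj: "B \<bullet> (N\<^sub>A *\<^sub>v x) = B\<^sub>A \<bullet> x" if "x \<in> carrier_vec k" for x
    using that assms by (simp add: transpose_vec_mult_scalar)
  let ?F = "{x \<in> carrier_vec k. 0\<^sub>v c \<le> N\<^sub>A *\<^sub>v x}"
  have "bdd_above ((\<lambda>x. - (B \<bullet> (N\<^sub>A *\<^sub>v x))) ` ?F)
    \<longleftrightarrow> (\<exists>v\<in>carrier_vec c. transpose_mat N\<^sub>A *\<^sub>v v = B\<^sub>A \<and> 0\<^sub>v c \<le> v)"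
  proof
    assume "bdd_above ((\<lambda>x. - (B \<bullet> (N\<^sub>A *\<^sub>v x))) ` ?F)"
    then obtain u where u: "\<And>x. x \<in> ?F \<Longrightarrow> - (B\<^sub>A \<bullet> x) \<le> u"
      by (auto simp: bdd_above_def obj)
    have "0 \<le> B\<^sub>A \<bullet> x" if x: "x \<in> carrier_vec k" "0\<^sub>v c \<le> N\<^sub>A *\<^sub>v x" for x
    proof (rule ccontr)
      assume neg: "\<not> 0 \<le> B\<^sub>A \<bullet> x"
      \<comment> \<open>Scaling stays in the cone \<open>?F\<close>; this factor raises the
        objective to exactly \<open>\<bar>u\<bar> + 1\<close>, which exceeds the bound
        \<open>u\<close>.\<close>
      define t where "t = (\<bar>u\<bar> + 1) / - (B\<^sub>A \<bullet> x)"
      have "0 \<le> t"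
        unfolding t_def by (rule divide_nonneg_nonneg) (use neg in linarith)+
      then have "t \<cdot>\<^sub>v x \<in> ?F"
        using x N by (auto simp: less_eq_vec_def)
      then have "- (B\<^sub>A \<bullet> (t \<cdot>\<^sub>v x)) \<le> u"
        by (rule u)
      moreover have "B\<^sub>A \<bullet> (t \<cdot>\<^sub>v x) = - (\<bar>u\<bar> + 1)"
        using neg x B\<^sub>A by (simp add: t_def)
      ultimately show False
        by simp
    qed
    from farkas_mat[OF N B\<^sub>A this]
    show "\<exists>v\<in>carrier_vec c. transpose_mat N\<^sub>A *\<^sub>v v = B\<^sub>A \<and> 0\<^sub>v c \<le> v"
      by blast
  next
    assume "\<exists>v\<in>carrier_vec c. transpose_mat N\<^sub>A *\<^sub>v v = B\<^sub>A \<and> 0\<^sub>v c \<le> v"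
    then obtain v where v: "v \<in> carrier_vec c" "transpose_mat N\<^sub>A *\<^sub>v v = B\<^sub>A" "0\<^sub>v c \<le> v"
      by blast
    \<comment> \<open>Weak duality: \<open>B \<bullet> (N\<^sub>A *\<^sub>v x)\<close> equals
      \<open>v \<bullet> (N\<^sub>A *\<^sub>v x)\<close>, a product of two nonnegative vectors.
      Hence 0 bounds the objective from above.\<close>
    have "0 \<le> B \<bullet> (N\<^sub>A *\<^sub>v x)" if "x \<in> ?F" for x
      using that v nonneg_scalar_prod[of c v "N\<^sub>A *\<^sub>v x"]
        transpose_vec_mult_scalar[OF N _ v(1), of x] by (simp add: obj)
    then show "bdd_above ((\<lambda>x. - (B \<bullet> (N\<^sub>A *\<^sub>v x))) ` ?F)"
      by (intro bdd_aboveI[of _ 0]) auto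
  qed
  then show ?thesis
    by (auto simp: lp_max_bounded_def lp_feasible_def)
qed

end
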